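(* The category $\mathbf{Learn}_{\mathscr{C}}$ of learners in a symmetric monoidal category $\mathscr{C}$, with its symmetric monoidal structure, is not compact closed in general; that is, there exists a symmetric monoidal category $\mathscr{C}$ such that $\mathbf{Learn}_{\mathscr{C}}$ is not compact closed.
   Context: $\mathscr{C}$ has tensor $\otimes$, unit $I$ and symmetry $s$; associators and unitors of $\mathscr{C}$ are suppressed in formulas. A learner from $(A,A')$ to $(B,B')$ is an element of the coend $\int^{P, Q : \mathscr{C}} \mathscr{C}(P \otimes A, Q \otimes B) \times \mathscr{C}(Q \otimes B', P \otimes A')$. Concretely, it is an equivalence class $(f \mid g)$ of a choice of parameter objects $P, Q$ and morphisms $f : P \otimes A \to Q \otimes B$, $g : Q \otimes B' \to P \otimes A'$, under the equivalence relation generated by $((q \otimes B) \circ f \circ (p \otimes A) \mid g) \sim (f \mid (p \otimes A') \circ g \circ (q \otimes B'))$ for all $p : P \to P'$, $q : Q \to Q'$, $f : P' \otimes A \to Q \otimes B$, $g : Q' \otimes B' \to P \otimes A'$. The category $\mathbf{Learn}_{\mathscr{C}}$ has objects the pairs $(A,A')$ of objects of $\mathscr{C}$ and morphisms the learners. The identity on $(A,A')$ is $(\mathrm{id}_{I \otimes A} \mid \mathrm{id}_{I \otimes A'})$. The composite of $(l_1 \mid r_1) : (A, A') \to (B, B')$ (parameters $P_1,Q_1$) followed by $(l_2 \mid r_2) : (B, B') \to (C, C')$ (parameters $P_2,Q_2$) has parameters $P_2 \otimes P_1$ and $Q_1 \otimes Q_2$ and is represented by $(Q_1 \otimes l_2)\circ(s_{P_2,Q_1}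 \otimes B)\circ(P_2 \otimes l_1)$ and $(P_2 \otimes r_1)\circ(s_{Q_1,P_2} \otimes B')\circ(Q_1 \otimes r_2)$. $\mathbf{Learn}_{\mathscr{C}}$ is symmetric monoidal with unit $(I,I)$, $(A, A') \otimes (B, B') := (A \otimes B, B' \otimes A')$, and, for $(l_i \mid r_i) : (A_i,A_i') \to (B_i,B_i')$ with parameters $P_i,Q_i$ ($i\in\{L,R\}$), $(l_L \mid r_L) \otimes (l_R \mid r_R)$ having parameters $P_L \otimes P_R$ and $Q_R \otimes Q_L$ and represented by $l_L \otimes l_R$ and $r_R \otimes r_L$ pre- and post-composed with the evident permutations of tensor factors, giving maps $P_L \otimes P_R \otimes A_L \otimes A_R \to Q_R \otimes Q_L \otimes B_L \otimes B_R$ and $Q_R \otimes Q_L \otimes B_R' \otimes B_L' \to P_L \otimes P_R \otimes A_R' \otimes A_L'$. There is a functor $\iota : \mathscr{C} \times \mathscr{C}^{\mathrm{op}} \to \mathbf{Learn}_{\mathscr{C}}$, the identity on objects, sending $f : A \to B$ and $g : B' \to A'$ to $(I \otimes f \mid I \otimes g) : (A,A') \to (B,B')$; the structure isomorphisms of $\mathbf{Learn}_{\mathscr{C}}$ are the images under $\iota$ of those of $\mathscr{C} \times \mathscr{C}^{\mathrm{op}}$ (with tensor reversed in the second factor). A symmetric monoidal category is compact closed if every object has a monoidal dual. *)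

theory Defs
  imports Main
begin

record ('o, 'a) smcat =
  Obj :: "'o set"
  Arr :: "'a set"
  Src :: "'a \<Rightarrow> 'o"
  Tgt :: "'a \<Rightarrow> 'o"
  Ide :: "'o \<Rightarrow> 'a"
  Comp :: "'a \<Rightarrow> 'a \<Rightarrow> 'a"  (infixr \<open>\<cdot>\<index>\<close> 55)
  TensO :: "'o \<Rightarrow> 'o \<Rightarrow> 'o"  (infixr \<open>\<odot>\<index>\<close> 70)
  TensA :: "'a \<Rightarrow> 'a \<Rightarrow> 'a"  (infixr \<open>\<otimes>\<index>\<close> 70)
  Unit :: "'o"
  Assoc :: "'o \<Rightarrow> 'o \<Rightarrow> 'o \<Rightarrow> 'a"
  LUnit :: "'o \<Rightarrow> 'a"
  RUnit :: "'o \<Rightarrow> 'a"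
  Symm :: "'o \<Rightarrow> 'o \<Rightarrow> 'a"

text \<open>Composition is written in applicative order: \<open>g \<cdot> f\<close> is \<open>g\<close> after \<open>f\<close>.\<close>

definition hom :: "('o, 'a) smcat \<Rightarrow> 'o \<Rightarrow> 'o \<Rightarrow> 'a set" where
  "hom C A B = {f \<in> Arr C. Src C f = A \<and> Tgt C f = B}"

definition inverse_arrows :: "('o, 'a) smcat \<Rightarrow> 'a \<Rightarrow> 'a \<Rightarrow> bool" where
  "inverse_arrows C f g \<longleftrightarrow>
     f \<in> Arr C \<and> g \<in> hom C (Tgt C f) (Src C f) \<and>
     g \<cdot>\<^bsub>C\<^esub> f = Ide C (Src C f) \<and> f \<cdot>\<^bsub>C\<^esub> g = Ide C (Tgt C f)"

definition is_iso :: "('o, 'a) smcat \<Rightarrow> 'a \<Rightarrow> bool" where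
  "is_iso C f \<longleftrightarrow> (\<exists>g. inverse_arrows C f g)"

definition inv_arr :: "('o, 'a) smcat \<Rightarrow> 'a \<Rightarrow> 'a" where
  "inv_arr C f = (THE g. inverse_arrows C f g)"

locale category =
  fixes C :: "('o, 'a) smcat" (structure)
  assumes arr_obj: "f \<in> Arr C \<Longrightarrow> Src C f \<in> Obj C \<and> Tgt C f \<in> Obj C"
    and ide_hom: "A \<in> Obj C \<Longrightarrow> Ide C A \<in> hom C A A"
    and comp_hom: "f \<in> hom C A B \<Longrightarrow> g \<in> hom C B D \<Longrightarrow> g \<cdot> f \<in> hom C A D"
    and comp_ide_left: "f \<in> hom C A B \<Longrightarrow> Ide C B \<cdot> f = f"
    and comp_ide_right: "f \<in> hom C A B \<Longrightarrow> f \<cdot> Ide C A = f"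
    and comp_assoc:
      "f \<in> hom C A B \<Longrightarrow> g \<in> hom C B D \<Longrightarrow> h \<in> hom C D E \<Longrightarrow> (h \<cdot> g) \<cdot> f = h \<cdot> (g \<cdot> f)"

locale monoidal_category = category +
  assumes unit_obj: "Unit C \<in> Obj C"
    and tensor_obj: "A \<in> Obj C \<Longrightarrow> B \<in> Obj C \<Longrightarrow> A \<odot> B \<in> Obj C"
    and tensor_hom:
      "f \<in> hom C A B \<Longrightarrow> g \<in> hom C A' B' \<Longrightarrow> f \<otimes> g \<in> hom C (A \<odot> A') (B \<odot> B')"
    and tensor_ide: "A \<in> Obj C \<Longrightarrow> B \<in> Obj C \<Longrightarrow> Ide C A \<otimes> Ide C B = Ide C (A \<odot> B)"
    and tensor_comp:
      "f \<in> hom C A B \<Longrightarrow> g \<in> hom C B D \<Longrightarrow> f' \<in> hom C A' B' \<Longrightarrow> g' \<in> hom C B' D' \<Longrightarrow>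
       (g \<cdot> f) \<otimes> (g' \<cdot> f') = (g \<otimes> g') \<cdot> (f \<otimes> f')"
    and assoc_hom:
      "A \<in> Obj C \<Longrightarrow> B \<in> Obj C \<Longrightarrow> D \<in> Obj C \<Longrightarrow>
       Assoc C A B D \<in> hom C ((A \<odot> B) \<odot> D) (A \<odot> (B \<odot> D))"
    and assoc_iso:
      "A \<in> Obj C \<Longrightarrow> B \<in> Obj C \<Longrightarrow> D \<in> Obj C \<Longrightarrow> is_iso C (Assoc C A B D)"
    and assoc_natural:
      "f \<in> hom C A A' \<Longrightarrow> g \<in> hom C B B' \<Longrightarrow> h \<in> hom C D D' \<Longrightarrow>
       Assoc C A' B' D' \<cdot> ((f \<otimes> g) \<otimes> h) = (f \<otimes> (g \<otimes> h)) \<cdot> Assoc C A B D"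
    and lunit_hom: "A \<in> Obj C \<Longrightarrow> LUnit C A \<in> hom C (Unit C \<odot> A) A"
    and lunit_iso: "A \<in> Obj C \<Longrightarrow> is_iso C (LUnit C A)"
    and lunit_natural:
      "f \<in> hom C A B \<Longrightarrow> LUnit C B \<cdot> (Ide C (Unit C) \<otimes> f) = f \<cdot> LUnit C A"
    and runit_hom: "A \<in> Obj C \<Longrightarrow> RUnit C A \<in> hom C (A \<odot> Unit C) A"
    and runit_iso: "A \<in> Obj C \<Longrightarrow> is_iso C (RUnit C A)"
    and runit_natural:
      "f \<in> hom C A B \<Longrightarrow> RUnit C B \<cdot> (f \<otimes> Ide C (Unit C)) = f \<cdot> RUnit C A"
    and pentagon:
      "A \<in> Obj C \<Longrightarrow> B \<in> Obj C \<Longrightarrow> D \<in> Obj C \<Longrightarrow> E \<in> Obj C \<Longrightarrow>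
       Assoc C A B (D \<odot> E) \<cdot> Assoc C (A \<odot> B) D E =
       (Ide C A \<otimes> Assoc C B D E) \<cdot> Assoc C A (B \<odot> D) E \<cdot> (Assoc C A B D \<otimes> Ide C E)"
    and triangle:
      "A \<in> Obj C \<Longrightarrow> B \<in> Obj C \<Longrightarrow>
       (Ide C A \<otimes> LUnit C B) \<cdot> Assoc C A (Unit C) B = RUnit C A \<otimes> Ide C B"

locale symmetric_monoidal_category = monoidal_category +
  assumes symm_hom: "A \<in> Obj C \<Longrightarrow> B \<in> Obj C \<Longrightarrow> Symm C A B \<in> hom C (A \<odot> B) (B \<odot> A)"
    and symm_natural:
      "f \<in> hom C A A' \<Longrightarrow> g \<in> hom C B B' \<Longrightarrow>
       Symm C A' B' \<cdot> (f \<otimes> g) = (g \<otimes> f) \<cdot> Symm C A B"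
    and symm_symm:
      "A \<in> Obj C \<Longrightarrow> B \<in> Obj C \<Longrightarrow> Symm C B A \<cdot> Symm C A B = Ide C (A \<odot> B)"
    and hexagon:
      "A \<in> Obj C \<Longrightarrow> B \<in> Obj C \<Longrightarrow> D \<in> Obj C \<Longrightarrow>
       Assoc C B D A \<cdot> Symm C A (B \<odot> D) \<cdot> Assoc C A B D =
       (Ide C B \<otimes> Symm C A D) \<cdot> Assoc C B A D \<cdot> (Symm C A B \<otimes> Ide C D)"

text \<open>\<open>X'\<close> is a monoidal dual of \<open>X\<close> with unit \<open>\<eta> : I \<rightarrow> X \<odot> X'\<close> and counit
  \<open>\<epsilon> : X' \<odot> X \<rightarrow> I\<close>, subject to the two triangle (zig-zag) equations.\<close>

definition is_dual :: "('o, 'a) smcat \<Rightarrow> 'o \<Rightarrow> 'o \<Rightarrow> 'a \<Rightarrow> 'a \<Rightarrow> bool" where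
  "is_dual C X X' \<eta> \<epsilon> \<longleftrightarrow>
     X \<in> Obj C \<and> X' \<in> Obj C \<and>
     \<eta> \<in> hom C (Unit C) (X \<odot>\<^bsub>C\<^esub> X') \<and> \<epsilon> \<in> hom C (X' \<odot>\<^bsub>C\<^esub> X) (Unit C) \<and>
     RUnit C X \<cdot>\<^bsub>C\<^esub> (Ide C X \<otimes>\<^bsub>C\<^esub> \<epsilon>) \<cdot>\<^bsub>C\<^esub> Assoc C X X' X \<cdot>\<^bsub>C\<^esub> (\<eta> \<otimes>\<^bsub>C\<^esub> Ide C X) \<cdot>\<^bsub>C\<^esub>
       inv_arr C (LUnit C X) = Ide C X \<and>
     LUnit C X' \<cdot>\<^bsub>C\<^esub> (\<epsilon> \<otimes>\<^bsub>C\<^esub> Ide C X') \<cdot>\<^bsub>C\<^esub> inv_arr C (Assoc C X' X X') \<cdot>\<^bsub>C\<^esub>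
       (Ide C X' \<otimes>\<^bsub>C\<^esub> \<eta>) \<cdot>\<^bsub>C\<^esub> inv_arr C (RUnit C X') = Ide C X'"

text \<open>Only the existence of duals is recorded here, so that the negation of
  \<open>compact_closed C\<close> really says that some object has no dual (and not that \<open>C\<close>
  violates an axiom of symmetric monoidal categories).\<close>

definition compact_closed :: "('o, 'a) smcat \<Rightarrow> bool" where
  "compact_closed C \<longleftrightarrow> (\<forall>X\<in>Obj C. \<exists>X' \<eta> \<epsilon>. is_dual C X X' \<eta> \<epsilon>)"

text \<open>A representative \<open>(P, Q, f, g)\<close> of a learner consists of the parameter objects and the
  morphisms \<open>f : P \<odot> A \<rightarrow> Q \<odot> B\<close> and \<open>g : Q \<odot> B' \<rightarrow> P \<odot> A'\<close>. A learner
  \<open>(X, Y, c)\<close> carries its source \<open>X = (A, A')\<close>, its target \<open>Y = (B, B')\<close> and the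
  equivalence class \<open>c\<close>.\<close>

type_synonym ('o, 'a) rep = "'o \<times> 'o \<times> 'a \<times> 'a"
type_synonym ('o, 'a) learner = "('o \<times> 'o) \<times> ('o \<times> 'o) \<times> ('o, 'a) rep set"

context
  fixes C :: "('o, 'a) smcat" (structure)
begin

definition reps :: "'o \<times> 'o \<Rightarrow> 'o \<times> 'o \<Rightarrow> ('o, 'a) rep set" where
  "reps = (\<lambda>(A, A') (B, B'). {(P, Q, f, g). P \<in> Obj C \<and> Q \<in> Obj C \<and>
     f \<in> hom C (P \<odot> A) (Q \<odot> B) \<and> g \<in> hom C (Q \<odot> B') (P \<odot> A')})"

inductive coend_step ::
    "'o \<times> 'o \<Rightarrow> 'o \<times> 'o \<Rightarrow> ('o, 'a) rep \<Rightarrow> ('o, 'a) rep \<Rightarrow> bool" where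
  "p \<in> hom C P P' \<Longrightarrow> q \<in> hom C Q Q' \<Longrightarrow>
   f \<in> hom C (P' \<odot> A) (Q \<odot> B) \<Longrightarrow> g \<in> hom C (Q' \<odot> B') (P \<odot> A') \<Longrightarrow>
   coend_step (A, A') (B, B')
     (P, Q', (q \<otimes> Ide C B) \<cdot> f \<cdot> (p \<otimes> Ide C A), g)
     (P', Q, f, (p \<otimes> Ide C A') \<cdot> g \<cdot> (q \<otimes> Ide C B'))"

definition learner_rel ::
    "'o \<times> 'o \<Rightarrow> 'o \<times> 'o \<Rightarrow> (('o, 'a) rep \<times> ('o, 'a) rep) set" where
  "learner_rel X Y =
     {(x, y). x \<in> reps X Y \<and> y \<in> reps X Y \<and> equivclp (coend_step X Y) x y}"

definition learners :: "('o, 'a) learner set" where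
  "learners = {(X, Y, c). X \<in> Obj C \<times> Obj C \<and> Y \<in> Obj C \<times> Obj C \<and>
     c \<in> reps X Y // learner_rel X Y}"

definition mk_learner :: "'o \<times> 'o \<Rightarrow> 'o \<times> 'o \<Rightarrow> ('o, 'a) rep \<Rightarrow> ('o, 'a) learner" where
  "mk_learner X Y x = (X, Y, learner_rel X Y `` {x})"

text \<open>For \<open>f : P1 \<odot> A \<rightarrow> Q1 \<odot> B\<close> and \<open>g : P2 \<odot> B \<rightarrow> Q2 \<odot> D\<close>, this is
  \<open>(Q1 \<otimes> g) \<circ> (s \<otimes> B) \<circ> (P2 \<otimes> f)\<close> with associators inserted, a morphism
  \<open>(P2 \<odot> P1) \<odot> A \<rightarrow> (Q1 \<odot> Q2) \<odot> D\<close>. The backward part of a composite learner has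
  the same shape, with the roles of the two learners exchanged.\<close>

definition seq ::
    "'o \<Rightarrow> 'o \<Rightarrow> 'o \<Rightarrow> 'o \<Rightarrow> 'o \<Rightarrow> 'o \<Rightarrow> 'o \<Rightarrow> 'a \<Rightarrow> 'a \<Rightarrow> 'a" where
  "seq P1 Q1 P2 Q2 A B D f g =
     inv_arr C (Assoc C Q1 Q2 D) \<cdot> (Ide C Q1 \<otimes> g) \<cdot> Assoc C Q1 P2 B \<cdot>
     (Symm C P2 Q1 \<otimes> Ide C B) \<cdot>
     inv_arr C (Assoc C P2 Q1 B) \<cdot> (Ide C P2 \<otimes> f) \<cdot> Assoc C P2 P1 A"

definition comp_rep ::
    "'o \<times> 'o \<Rightarrow> 'o \<times> 'o \<Rightarrow> 'o \<times> 'o \<Rightarrow> ('o, 'a) rep \<Rightarrow> ('o, 'a) rep \<Rightarrow> ('o, 'a) rep" where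
  "comp_rep = (\<lambda>(A, A') (B, B') (D, D') (P1, Q1, l1, r1) (P2, Q2, l2, r2).
     (P2 \<odot> P1, Q1 \<odot> Q2,
      seq P1 Q1 P2 Q2 A B D l1 l2,
      seq Q2 P2 Q1 P1 D' B' A' r2 r1))"

text \<open>The operation on classes is the class of the composite of any two representatives
  (all these classes coincide, so their union is that common class).\<close>

definition learn_comp :: "('o, 'a) learner \<Rightarrow> ('o, 'a) learner \<Rightarrow> ('o, 'a) learner" where
  "learn_comp = (\<lambda>(Y', Z, d) (X, Y, c).
     (X, Z, \<Union>x\<in>c. \<Union>y\<in>d. learner_rel X Z `` {comp_rep X Y Z x y}))"

definition learn_ide :: "'o \<times> 'o \<Rightarrow> ('o, 'a) learner" where
  "learn_ide = (\<lambda>(A, A'). mk_learner (A, A') (A, A')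
     (Unit C, Unit C, Ide C (Unit C \<odot> A), Ide C (Unit C \<odot> A')))"

definition learn_tens_obj :: "'o \<times> 'o \<Rightarrow> 'o \<times> 'o \<Rightarrow> 'o \<times> 'o" where
  "learn_tens_obj = (\<lambda>(A, A') (B, B'). (A \<odot> B, B' \<odot> A'))"

text \<open>The middle-four interchange
  \<open>(P \<odot> Q) \<odot> (A \<odot> B) \<rightarrow> (P \<odot> A) \<odot> (Q \<odot> B)\<close>.\<close>

definition interchange :: "'o \<Rightarrow> 'o \<Rightarrow> 'o \<Rightarrow> 'o \<Rightarrow> 'a" where
  "interchange P Q A B =
     inv_arr C (Assoc C P A (Q \<odot> B)) \<cdot>
     (Ide C P \<otimes>
        (Assoc C A Q B \<cdot> (Symm C Q A \<otimes> Ide C B) \<cdot> inv_arr C (Assoc C Q A B))) \<cdot>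
     Assoc C P Q (A \<odot> B)"

text \<open>For \<open>f : P \<odot> A \<rightarrow> Q \<odot> B\<close> and \<open>f' : P' \<odot> A' \<rightarrow> Q' \<odot> B'\<close>, this is
  \<open>f \<otimes> f'\<close> conjugated by permutations to a morphism
  \<open>(P \<odot> P') \<odot> (A \<odot> A') \<rightarrow> (Q' \<odot> Q) \<odot> (B \<odot> B')\<close>; note the reversal of the
  \<open>Q\<close>-parameters.\<close>

definition par ::
    "'o \<Rightarrow> 'o \<Rightarrow> 'o \<Rightarrow> 'o \<Rightarrow> 'a \<Rightarrow> 'o \<Rightarrow> 'o \<Rightarrow> 'o \<Rightarrow> 'o \<Rightarrow> 'a \<Rightarrow> 'a" where
  "par P Q A B f P' Q' A' B' f' =
     (Symm C Q Q' \<otimes> Ide C (B \<odot> B')) \<cdot> interchange Q B Q' B' \<cdot>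
     (f \<otimes> f') \<cdot> interchange P P' A A'"

definition tens_rep ::
    "'o \<times> 'o \<Rightarrow> 'o \<times> 'o \<Rightarrow> ('o, 'a) rep \<Rightarrow> 'o \<times> 'o \<Rightarrow> 'o \<times> 'o \<Rightarrow> ('o, 'a) rep \<Rightarrow> ('o, 'a) rep"
  where
  "tens_rep = (\<lambda>(AL, AL') (BL, BL') (PL, QL, lL, rL) (AR, AR') (BR, BR') (PR, QR, lR, rR).
     (PL \<odot> PR, QR \<odot> QL,
      par PL QL AL BL lL PR QR AR BR lR,
      par QR PR BR' AR' rR QL PL BL' AL' rL))"

definition learn_tens :: "('o, 'a) learner \<Rightarrow> ('o, 'a) learner \<Rightarrow> ('o, 'a) learner" where
  "learn_tens = (\<lambda>(X, Y, c) (X', Y', d).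
     let S = learn_tens_obj X X'; T = learn_tens_obj Y Y' in
     (S, T, \<Union>x\<in>c. \<Union>y\<in>d. learner_rel S T `` {tens_rep X Y x X' Y' y}))"

text \<open>The functor \<open>\<iota>\<close> on a morphism \<open>f : A \<rightarrow> B\<close> of \<open>C\<close> and a morphism of the opposite
  category given by \<open>g : B' \<rightarrow> A'\<close> in \<open>C\<close>.\<close>

definition iota :: "'a \<Rightarrow> 'a \<Rightarrow> ('o, 'a) learner" where
  "iota f g = mk_learner (Src C f, Tgt C g) (Tgt C f, Src C g)
     (Unit C, Unit C, Ide C (Unit C) \<otimes> f, Ide C (Unit C) \<otimes> g)"

text \<open>Structure isomorphisms: the second component points backwards and lives in \<open>C\<close> with
  reversed tensor, which is why left and right unitors are swapped there and the arguments
  of the associator are reversed.\<close>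

definition Learn :: "('o \<times> 'o, ('o, 'a) learner) smcat" where
  "Learn = \<lparr>
     Obj = Obj C \<times> Obj C,
     Arr = learners,
     Src = (\<lambda>(X, Y, c). X),
     Tgt = (\<lambda>(X, Y, c). Y),
     Ide = learn_ide,
     Comp = learn_comp,
     TensO = learn_tens_obj,
     TensA = learn_tens,
     Unit = (Unit C, Unit C),
     Assoc = (\<lambda>(A, A') (B, B') (D, D'). iota (Assoc C A B D) (Assoc C D' B' A')),
     LUnit = (\<lambda>(A, A'). iota (LUnit C A) (inv_arr C (RUnit C A'))),
     RUnit = (\<lambda>(A, A'). iota (RUnit C A) (inv_arr C (LUnit C A'))),
     Symm = (\<lambda>(A, A') (B, B'). iota (Symm C A B) (Symm C A' B')) \<rparr>"

end

end

theory Submission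
  imports Defs
begin

text \<open>
  A witness is the discrete category on the additive monoid of natural numbers: its only
  arrows are identities and its tensor product is addition. There the coend identifies
  nothing, and a learner \<open>(A, A') \<rightarrow> (B, B')\<close> is just a pair of parameters \<open>(P, Q)\<close> with
  \<open>P + A = Q + B\<close> and \<open>Q + B' = P + A'\<close>. Composition and tensor product both add parameters
  componentwise, and every structure isomorphism has parameters \<open>(0, 0)\<close>, so that the
  axioms of a symmetric monoidal category become identities between sums (lemmas
  \<open>hom_Learn\<close>, \<open>comp_shift\<close>, \<open>tensor_shift\<close> and \<open>symmetric_monoidal_Learn\<close>).

  The parameters record a cost that can never be paid back. A zig-zag equation says that a
  composite in which the unit \<open>\<eta>\<close> occurs has parameters \<open>(0, 0)\<close>. Since parameters only add
  and natural numbers have no negatives, \<open>\<eta>\<close> itself has parameters \<open>(0, 0)\<close>, and is thus an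
  identity. So an object with a dual is invertible for addition, hence zero
  (lemma \<open>dual_imp_zero\<close>). In particular, \<open>(1, 0)\<close> has no dual.
\<close>

section \<open>The discrete category on the natural numbers\<close>

text \<open>Composition is only meaningful on equal arguments, and there it returns them.\<close>

definition disc :: "(nat, nat) smcat" where
  "disc = \<lparr>Obj = UNIV, Arr = UNIV, Src = (\<lambda>n. n), Tgt = (\<lambda>n. n), Ide = (\<lambda>n. n),
     Comp = (\<lambda>g f. f), TensO = (+), TensA = (+), Unit = 0,
     Assoc = (\<lambda>a b c. a + b + c), LUnit = (\<lambda>n. n), RUnit = (\<lambda>n. n), Symm = (+)\<rparr>"

lemma disc_simps [simp]:
  "Obj disc = UNIV" "Arr disc = UNIV" "Src disc n = n" "Tgt disc n = n" "Ide disc n = n"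
  "Comp disc m n = n" "TensO disc = (+)" "TensA disc = (+)" "Unit disc = 0"
  "Assoc disc a b c = a + b + c" "LUnit disc n = n" "RUnit disc n = n" "Symm disc = (+)"
  by (simp_all add: disc_def)

lemma hom_disc [simp]: "f \<in> hom disc a b \<longleftrightarrow> f = a \<and> a = b"
  by (auto simp: hom_def)

lemma inverse_arrows_disc [simp]: "inverse_arrows disc f g \<longleftrightarrow> g = f"
  by (auto simp: inverse_arrows_def)

lemma inv_arr_disc [simp]: "inv_arr disc f = f"
  by (simp add: inv_arr_def)

lemma symmetric_monoidal_disc: "symmetric_monoidal_category disc"
  by unfold_locales (auto simp: is_iso_def)

section \<open>Learners in the discrete category\<close>

text \<open>A sliding step moves only identities across the bar, so it changes nothing.\<close>

lemma coend_step_disc: "coend_step disc X Y x y \<Longrightarrow> x = y"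
  by (auto elim!: coend_step.cases)

lemma learner_rel_disc: "learner_rel disc X Y = Id_on (reps disc X Y)"
proof -
  have "equivclp (coend_step disc X Y) x y \<longleftrightarrow> x = y" for x y
  proof
    show "equivclp (coend_step disc X Y) x y \<Longrightarrow> x = y"
      by (induction rule: equivclp_induct) (auto dest: coend_step_disc)
  qed simp
  then show ?thesis
    by (auto simp: learner_rel_def Id_on_def)
qed

definition balanced :: "nat \<times> nat \<Rightarrow> nat \<times> nat \<Rightarrow> nat \<Rightarrow> nat \<Rightarrow> bool" where
  "balanced X Y P Q \<longleftrightarrow> P + fst X = Q + fst Y \<and> Q + snd Y = P + snd X"

text \<open>A learner is determined by its parameters. An arrow of \<open>disc\<close> is the object it is the
  identity of, so for balanced parameters the two entries after \<open>P\<close> and \<open>Q\<close> are the only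
  possible forward and backward arrows.\<close>

definition shift :: "nat \<times> nat \<Rightarrow> nat \<times> nat \<Rightarrow> nat \<Rightarrow> nat \<Rightarrow> (nat, nat) learner" where
  "shift X Y P Q = (X, Y, {(P, Q, P + fst X, Q + snd Y)})"

lemma shift_inject [simp]:
  "shift X Y P Q = shift X' Y' P' Q' \<longleftrightarrow> X = X' \<and> Y = Y' \<and> P = P' \<and> Q = Q'"
  by (auto simp: shift_def)

lemma reps_disc:
  "x \<in> reps disc X Y \<longleftrightarrow> (\<exists>P Q. balanced X Y P Q \<and> x = (P, Q, P + fst X, Q + snd Y))"
  by (cases X; cases Y; cases x) (auto simp: reps_def balanced_def)

lemma class_disc:
  "balanced X Y P Q \<Longrightarrow>
   learner_rel disc X Y `` {(P, Q, P + fst X, Q + snd Y)} = {(P, Q, P + fst X, Q + snd Y)}"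
  by (auto simp: learner_rel_disc reps_disc)

lemma learners_disc:
  "l \<in> learners disc \<longleftrightarrow> (\<exists>X Y P Q. balanced X Y P Q \<and> l = shift X Y P Q)"
proof -
  have "c \<in> reps disc X Y // learner_rel disc X Y \<longleftrightarrow> (\<exists>x\<in>reps disc X Y. c = {x})" for X Y c
    by (auto simp: quotient_def learner_rel_disc Id_on_def)
  then have "c \<in> reps disc X Y // learner_rel disc X Y \<longleftrightarrow>
      (\<exists>P Q. balanced X Y P Q \<and> c = {(P, Q, P + fst X, Q + snd Y)})" for X Y c
    unfolding Bex_def reps_disc by blast
  then show ?thesis
    by (cases l) (simp add: learners_def shift_def mem_Times_iff del: split_paired_Ex)
qed

abbreviation Lrn :: "(nat \<times> nat, (nat, nat) learner) smcat" where
  "Lrn \<equiv> Learn disc"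

lemma hom_Learn: "l \<in> hom Lrn X Y \<longleftrightarrow> (\<exists>P Q. balanced X Y P Q \<and> l = shift X Y P Q)"
  by (auto simp: hom_def Learn_def learners_disc shift_def simp del: split_paired_Ex)

lemma hom_LearnE:
  assumes "l \<in> hom Lrn X Y"
  obtains P Q where "balanced X Y P Q" "l = shift X Y P Q"
  using assms by (auto simp: hom_Learn)

section \<open>The operations on parameters\<close>

lemma obj_Learn [simp]: "Obj Lrn = UNIV"
  by (simp add: Learn_def)

lemma unit_Learn [simp]: "Unit Lrn = (0, 0)"
  by (simp add: Learn_def)

lemma tensor_obj_Learn [simp]: "X \<odot>\<^bsub>Lrn\<^esub> Y = (fst X + fst Y, snd Y + snd X)"
  by (cases X; cases Y) (simp add: Learn_def learn_tens_obj_def)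

lemma ide_Learn: "Ide Lrn X = shift X X 0 0"
  using class_disc[of X X 0 0]
  by (cases X) (simp add: Learn_def learn_ide_def mk_learner_def shift_def balanced_def)

lemma comp_shift:
  assumes "balanced X Y P Q" "balanced Y Z P' Q'"
  shows "shift Y Z P' Q' \<cdot>\<^bsub>Lrn\<^esub> shift X Y P Q = shift X Z (P + P') (Q + Q')"
proof -
  \<comment> \<open>The forward parameter of a composite lists the second learner first.\<close>
  have "balanced X Z (P' + P) (Q + Q')"
    using assms by (simp add: balanced_def)
  from class_disc[OF this] show ?thesis
    by (cases X; cases Y; cases Z)
      (simp add: Learn_def learn_comp_def shift_def comp_rep_def seq_def add.commute)
qed

lemma tensor_shift:
  assumes "balanced X Y P Q" "balanced X' Y' P' Q'"
  shows "shift X Y P Q \<otimes>\<^bsub>Lrn\<^esub> shift X' Y' P' Q' =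
    shift (X \<odot>\<^bsub>Lrn\<^esub> X') (Y \<odot>\<^bsub>Lrn\<^esub> Y') (P + P') (Q + Q')"
proof -
  \<comment> \<open>The tensor product reverses the order of the \<open>Q\<close>-parameters.\<close>
  have "balanced (X \<odot>\<^bsub>Lrn\<^esub> X') (Y \<odot>\<^bsub>Lrn\<^esub> Y') (P + P') (Q' + Q)"
    using assms by (simp add: balanced_def)
  from class_disc[OF this] show ?thesis
    by (cases X; cases Y; cases X'; cases Y')
      (simp add: Learn_def learn_tens_def learn_tens_obj_def shift_def tens_rep_def par_def
        interchange_def add.commute)
qed

lemma iota_disc: "iota disc a b = shift (a, b) (a, b) 0 0"
  using class_disc[of "(a, b)" "(a, b)" 0 0]
  by (simp add: iota_def mk_learner_def shift_def balanced_def)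

text \<open>The structure of \<open>disc\<close> is strict, and strictly symmetric because addition is
  commutative. The order of the factors in \<open>Symm\<close> is therefore immaterial.\<close>

lemma structure_Learn [simp]:
  "Assoc Lrn X Y Z = Ide Lrn (X \<odot>\<^bsub>Lrn\<^esub> Y \<odot>\<^bsub>Lrn\<^esub> Z)"
  "LUnit Lrn X = Ide Lrn X"
  "RUnit Lrn X = Ide Lrn X"
  "Symm Lrn X Y = Ide Lrn (X \<odot>\<^bsub>Lrn\<^esub> Y)"
proof -
  show "Assoc Lrn X Y Z = Ide Lrn (X \<odot>\<^bsub>Lrn\<^esub> Y \<odot>\<^bsub>Lrn\<^esub> Z)"
    by (cases X; cases Y; cases Z) (simp add: ide_Learn, simp add: Learn_def iota_disc add_ac)
  show "LUnit Lrn X = Ide Lrn X" "RUnit Lrn X = Ide Lrn X"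
    by (cases X; simp add: ide_Learn; simp add: Learn_def iota_disc)+
  show "Symm Lrn X Y = Ide Lrn (X \<odot>\<^bsub>Lrn\<^esub> Y)"
    by (cases X; cases Y) (simp add: ide_Learn, simp add: Learn_def iota_disc add_ac)
qed

section \<open>The symmetric monoidal structure\<close>

lemma category_Learn: "category Lrn"
proof
  fix f
  show "f \<in> Arr Lrn \<Longrightarrow> Src Lrn f \<in> Obj Lrn \<and> Tgt Lrn f \<in> Obj Lrn"
    by simp
qed (auto simp: hom_Learn ide_Learn comp_shift balanced_def add_ac)

lemma (in category) inverse_arrows_ide:
  assumes "A \<in> Obj C"
  shows "inverse_arrows C (Ide C A) g \<longleftrightarrow> g = Ide C A"
  using ide_hom[OF assms] comp_ide_left[OF ide_hom[OF assms]] comp_ide_right[of g A A]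
  by (auto simp: inverse_arrows_def hom_def)

lemma (in category) is_iso_ide: "A \<in> Obj C \<Longrightarrow> is_iso C (Ide C A)"
  by (simp add: is_iso_def inverse_arrows_ide)

lemma (in category) inv_arr_ide: "A \<in> Obj C \<Longrightarrow> inv_arr C (Ide C A) = Ide C A"
  by (simp add: inv_arr_def inverse_arrows_ide)

lemma symmetric_monoidal_Learn: "symmetric_monoidal_category Lrn"
proof -
  interpret category Lrn by (rule category_Learn)
  show ?thesis
    by unfold_locales
      (auto elim!: hom_LearnE simp: is_iso_ide,
       auto simp: hom_Learn ide_Learn comp_shift tensor_shift balanced_def add_ac)
qed

section \<open>Objects with a dual\<close>

text \<open>The parameters of \<open>\<eta> : (0, 0) \<rightarrow> X \<odot> X'\<close> satisfy \<open>P = Q + A + B\<close> and \<open>P = Q + A' + B'\<close>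
  for \<open>X = (A, A')\<close> and \<open>X' = (B, B')\<close>. So \<open>X\<close> vanishes as soon as \<open>P\<close> does.\<close>

lemma dual_imp_zero:
  assumes "is_dual Lrn X X' \<eta> \<epsilon>"
  shows "X = (0, 0)"
proof -
  interpret category Lrn by (rule category_Learn)
  from assms obtain P Q P' Q'
    where bal: "balanced (0, 0) (X \<odot>\<^bsub>Lrn\<^esub> X') P Q" "balanced (X' \<odot>\<^bsub>Lrn\<^esub> X) (0, 0) P' Q'"
      and eq: "\<eta> = shift (0, 0) (X \<odot>\<^bsub>Lrn\<^esub> X') P Q" "\<epsilon> = shift (X' \<odot>\<^bsub>Lrn\<^esub> X) (0, 0) P' Q'"
    unfolding is_dual_def by (auto elim!: hom_LearnE simp del: tensor_obj_Learn)
  \<comment> \<open>A zig-zag equation, with identities for the structure isomorphisms.\<close>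
  have "Ide Lrn X \<cdot>\<^bsub>Lrn\<^esub> (Ide Lrn X \<otimes>\<^bsub>Lrn\<^esub> \<epsilon>) \<cdot>\<^bsub>Lrn\<^esub>
      Ide Lrn (X \<odot>\<^bsub>Lrn\<^esub> X' \<odot>\<^bsub>Lrn\<^esub> X) \<cdot>\<^bsub>Lrn\<^esub> (\<eta> \<otimes>\<^bsub>Lrn\<^esub> Ide Lrn X) \<cdot>\<^bsub>Lrn\<^esub> Ide Lrn X = Ide Lrn X"
    using assms by (simp add: is_dual_def inv_arr_ide)
  \<comment> \<open>Of the factors, only \<open>\<eta>\<close> and \<open>\<epsilon>\<close> contribute parameters.\<close>
  then have "shift X X (P + P') (Q + Q') = shift X X 0 0"
    using bal by (simp add: eq ide_Learn comp_shift tensor_shift balanced_def add_ac)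
  then have "P = 0"
    by simp
  with bal(1) show ?thesis
    by (simp add: balanced_def prod_eq_iff)
qed

theorem proposition2p4:
  shows "\<exists>C :: (nat, nat) smcat.
    symmetric_monoidal_category C \<and>
    symmetric_monoidal_category (Learn C) \<and>
    \<not> compact_closed (Learn C)"
proof (intro exI conjI)
  show "symmetric_monoidal_category disc"
    by (rule symmetric_monoidal_disc)
  show "symmetric_monoidal_category Lrn"
    by (rule symmetric_monoidal_Learn)
  show "\<not> compact_closed Lrn"
    unfolding compact_closed_def using dual_imp_zero
    by (metis UNIV_I obj_Learn one_neq_zero prod.inject)
qed

end
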